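(* Let $F=\{(f_1,g_1),\dots,(f_k,g_k)\}$ be a system of min-plus polynomials in $n$ variables. (a) Over the semiring $\mathbb{R}$: $F$ has a root in $\mathbb{R}^n$ if and only if the infinite Macaulay min-plus linear system $\mathit{Ml}\odot\vec y=\mathit{Mr}\odot\vec y$ has a solution over $\mathbb{R}$. (b) Over the semiring $\mathbb{R}_\infty$: $F$ has a root in $\mathbb{R}_\infty^n$ if and only if the infinite non-homogeneous Macaulay min-plus linear system $\mathit{Ml}\odot(0,\vec y)=\mathit{Mr}\odot(0,\vec y)$ has a solution over $\mathbb{R}_\infty$.
   Context: $\mathbb{R}_\infty=\mathbb{R}\cup\{+\infty\}$. Tropical operations on $\mathbb{K}\in\{\mathbb{R},\mathbb{R}_\infty\}$: $x\oplus y=\min\{x,y\}$, $x\odot y=x+y$. A tropical monomial is $m(\vec x)=c\odot \vec x^{I}$ with $c\in\mathbb{K}$, $I=(i_1,\dots,i_n)\in\mathbb{Z}_{\ge0}^n$ and $\vec x^{I}=i_1x_1+\dots+i_nx_n$ in classical notation (with $0\cdot\infty=0$). A tropical polynomial is a finite tropical sum $f=\min_i m_i$ of monomials with pairwise distinct exponent vectors. A min-plus polynomial is a pair $(f,g)$ of tropical polynomials; $\vec a\in\mathbb{K}^n$ is a root of $(f,g)$ if $f(\vec a)=g(\vec a)$. A root of a system is a common root of all its members. Infinite Macaulay matrices: $\mathit{Ml}$ and $\mathit{Mr}$ have columns indexed by $I\in\mathbb{Z}_{\ge0}^n$ and rows indexed by pairs $(j,J)$, $1\le j\le k$, $J\in\mathbb{Z}_{\ge0}^n$;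 the entry of $\mathit{Ml}$ (resp. $\mathit{Mr}$) in row $(j,J)$ and column $I$ is the coefficient of $\vec x^I$ in $\vec x^J\odot f_j$ (resp. $\vec x^J\odot g_j$), equal to $\infty$ if there is no such monomial. Each row has finitely many finite entries. For a matrix $A$ of this kind, $A\odot\vec y$ is the vector whose coordinate at row $r$ is $\min_I(a_{r,I}+y_I)$. Over $\mathbb{R}$ a solution $\vec y=(y_I)_I$ must have all coordinates finite. Over $\mathbb{R}_\infty$, a solution of the non-homogeneous system is a solution with coordinates in $\mathbb{R}_\infty$ whose coordinate corresponding to $I=\vec0$ (the constant monomial) equals $0$. *)

theory Defs
  imports "HOL-Analysis.Analysis"
begin

text \<open>
  The carriers of the two min-plus semirings, as subsets of \<^typ>\<open>ereal\<close>. There, tropical addition is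
  \<^const>\<open>min\<close>, tropical multiplication is \<open>+\<close>, and \<open>0 * \<infinity> = 0\<close> holds.
\<close>

definition R_fin :: "ereal set" where
  "R_fin = range ereal"

definition R_inf :: "ereal set" where
  "R_inf = range ereal \<union> {\<infinity>}"

text \<open>
  A polynomial is given by its coefficients: \<open>p I\<close> is the coefficient of the monomial with exponent
  vector \<open>I\<close>, and \<open>\<infinity>\<close> if there is no such monomial. The number of variables is \<open>CARD('n)\<close>.
\<close>

type_synonym 'n trop_poly = "nat ^ 'n \<Rightarrow> ereal"

text \<open>
  The set \<open>S\<close> below collects the exponent vectors of the monomials of \<open>p\<close>. It is nonempty: an empty
  minimum is not an element of \<open>\<real>\<close>, whereas over \<^term>\<open>R_inf\<close> the constant polynomial \<open>\<infinity>\<close> arises from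
  a monomial with coefficient \<open>\<infinity>\<close>.
\<close>

definition trop_poly_over :: "ereal set \<Rightarrow> 'n::finite trop_poly \<Rightarrow> bool" where
  "trop_poly_over K p \<longleftrightarrow>
    (\<exists>S. finite S \<and> S \<noteq> {} \<and> (\<forall>I\<in>S. p I \<in> K) \<and> (\<forall>I. I \<notin> S \<longrightarrow> p I = \<infinity>))"

definition monom_value :: "nat ^ 'n \<Rightarrow> ereal ^ 'n::finite \<Rightarrow> ereal" where
  "monom_value I x = (\<Sum>i\<in>UNIV. ereal (real (I $ i)) * x $ i)"

text \<open>
  The infimum is a minimum, since all but finitely many of the terms are \<open>\<infinity>\<close>; the same
  holds for the matrix-vector product below.
\<close>

definition trop_eval :: "'n::finite trop_poly \<Rightarrow> ereal ^ 'n \<Rightarrow> ereal" where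
  "trop_eval p x = (INF I. p I + monom_value I x)"

type_synonym 'n minplus_system = "('n trop_poly \<times> 'n trop_poly) list"

definition minplus_system_over :: "ereal set \<Rightarrow> 'n::finite minplus_system \<Rightarrow> bool" where
  "minplus_system_over K F \<longleftrightarrow> (\<forall>(f, g)\<in>set F. trop_poly_over K f \<and> trop_poly_over K g)"

definition is_root :: "'n::finite minplus_system \<Rightarrow> ereal ^ 'n \<Rightarrow> bool" where
  "is_root F x \<longleftrightarrow> (\<forall>(f, g)\<in>set F. trop_eval f x = trop_eval g x)"

text \<open>The coefficients of the tropical product of the monomial \<open>x\<^sup>J\<close> and \<open>p\<close>.\<close>

definition monom_mult :: "nat ^ 'n \<Rightarrow> 'n::finite trop_poly \<Rightarrow> 'n trop_poly" where
  "monom_mult J p = (\<lambda>I. if \<forall>i. J $ i \<le> I $ i then p (I - J) else \<infinity>)"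

text \<open>
  Rows are indexed by \<open>(j, J)\<close> with \<open>j < length F\<close> (counting from 0), columns by exponent vectors.
\<close>

type_synonym 'n macaulay_matrix = "nat \<times> (nat ^ 'n) \<Rightarrow> nat ^ 'n \<Rightarrow> ereal"

definition Ml :: "'n::finite minplus_system \<Rightarrow> 'n macaulay_matrix" where
  "Ml F = (\<lambda>(j, J). monom_mult J (fst (F ! j)))"

definition Mr :: "'n::finite minplus_system \<Rightarrow> 'n macaulay_matrix" where
  "Mr F = (\<lambda>(j, J). monom_mult J (snd (F ! j)))"

definition trop_mat_vec :: "('r \<Rightarrow> 'c \<Rightarrow> ereal) \<Rightarrow> ('c \<Rightarrow> ereal) \<Rightarrow> 'r \<Rightarrow> ereal" where
  "trop_mat_vec A y = (\<lambda>r. INF c. A r c + y c)"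

definition solves_macaulay :: "'n::finite minplus_system \<Rightarrow> (nat ^ 'n \<Rightarrow> ereal) \<Rightarrow> bool" where
  "solves_macaulay F y \<longleftrightarrow>
    (\<forall>j<length F. \<forall>J. trop_mat_vec (Ml F) y (j, J) = trop_mat_vec (Mr F) y (j, J))"

end

theory Submission
  imports Defs "HOL-Library.Set_Algebras"
begin

text \<open>
  A root \<open>a\<close> gives the solution \<open>y\<^sub>I = a\<^sup>I\<close> of the Macaulay system, because shifting by \<open>J\<close> only adds the
  constant \<open>a\<^sup>J\<close> to both sides of a row. The content is the converse, and it cannot be read off from
  \<open>y\<close> directly: a solution may look like \<open>y\<^sub>I = - I\<^sup>2\<close>, and then no
  tropical combination of its shifts is a linear function of \<open>I\<close>.

  The proof regards \<open>y\<close> as a tropically linear functional on polynomials and passes to the preorder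
  \<open>U \<sqsubseteq> V\<close>, meaning \<open>y(U H S) \<le> y(V H S)\<close> for some nonzero \<open>H\<close> and all \<open>S\<close>. It respects sums and
  products, satisfies the cancellation law, makes each \<open>f\<^sub>j\<close> equivalent to \<open>g\<^sub>j\<close>, and still separates the real
  constants (\<open>trop_preorder_pairing\<close>). So polynomials modulo this preorder form, up to fractions, a
  lattice-ordered abelian group containing \<open>\<real>\<close>. Such a group has a totally ordered quotient in which
  \<open>\<real>\<close> survives; only finitely many comparisons of monomials matter here, and these are decided one
  after the other (\<open>adjoin_dichotomy\<close>, \<open>total_extension\<close>).

  In a total order each \<open>f\<^sub>j\<close> and each \<open>g\<^sub>j\<close> is equivalent to its least monomial. The values of the
  variables in the ordered group may be infinitely large compared with \<open>\<real>\<close>, but the relevant order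
  relations between monomials are finitely many linear inequalities with integral slopes, and
  Fourier-Motzkin elimination turns their consistency into a real solution (\<open>real_point\<close>). At this
  point the least monomials of \<open>f\<^sub>j\<close> and \<open>g\<^sub>j\<close> are minimal and agree in value, so it is a root
  (\<open>common_point\<close>).

  If \<open>y\<close> takes the value \<open>\<infinity>\<close>, then first one finds a set \<open>W\<close> of variables and a shift of \<open>y\<close> which
  is \<open>\<infinity>\<close> at all monomials involving a variable outside \<open>W\<close>, and whose finite values reach
  arbitrarily far in the directions of \<open>W\<close> (\<open>maximal_direction_of_set\<close>). The argument above then gives
  real values to the variables in \<open>W\<close>; the other variables are set to \<open>\<infinity>\<close>.
\<close>

section \<open>Linear inequalities with integral slopes\<close>

lemma between_finite_sets:
  fixes L U :: "real set"
  assumes "finite L" "finite U" "\<And>l u. l \<in> L \<Longrightarrow> u \<in> U \<Longrightarrow> l \<le> u"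
  shows "\<exists>t. (\<forall>l\<in>L. l \<le> t) \<and> (\<forall>u\<in>U. t \<le> u)"
proof (cases "U = {}")
  case True
  then show ?thesis
    using assms(1) by (cases "L = {}") (auto intro!: exI[of _ "Max L"])
next
  case False
  then have "Min U \<in> U" using assms(2) by simp
  then show ?thesis
    using assms by (auto intro!: exI[of _ "Min U"])
qed

lemma additive_set_multiple:
  fixes K :: "(real \<times> ('n \<Rightarrow> int)) set"
  assumes add: "\<And>c v d w. (c, v) \<in> K \<Longrightarrow> (d, w) \<in> K \<Longrightarrow> (c + d, \<lambda>i. v i + w i) \<in> K"
    and mem: "(c, v) \<in> K" and "m > 0"
  shows "(of_int m * c, \<lambda>i. m * v i) \<in> K"
  using \<open>m > 0\<close>
proof (induction m rule: int_gr_induct)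
  case base
  then show ?case using mem by simp
next
  case (step m)
  have "(of_int m * c + c, \<lambda>i. m * v i + v i) \<in> K"
    using add[OF step(2) mem] .
  then show ?case by (simp add: algebra_simps)
qed

text \<open>
  Farkas' lemma with integral multipliers: the elements of \<open>K\<close> are inequalities, and since \<open>K\<close> is closed
  under addition, a contradiction derivable from \<open>D\<close> by Fourier-Motzkin elimination would be a
  constant inequality in \<open>K\<close>. Only integral multipliers occur, because the slopes are integral, so
  closure under addition suffices. Finiteness of \<open>D\<close> matters: the elimination has to choose the
  value of a variable between finitely many lower and upper bounds, one kind of which may be absent.
\<close>

lemma fourier_motzkin:
  fixes K :: "(real \<times> ('n \<Rightarrow> int)) set"
  assumes add: "\<And>c v d w. (c, v) \<in> K \<Longrightarrow> (d, w) \<in> K \<Longrightarrow> (c + d, \<lambda>i. v i + w i) \<in> K"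
    and const: "\<And>c. (c, \<lambda>i. 0) \<in> K \<Longrightarrow> c \<le> 0"
    and "finite V" "finite D" "D \<subseteq> K"
    and "\<And>c v i. (c, v) \<in> D \<Longrightarrow> i \<notin> V \<Longrightarrow> v i = 0"
  shows "\<exists>a. \<forall>(c, v)\<in>D. c + (\<Sum>i\<in>V. of_int (v i) * a i) \<le> 0"
  using assms(3-6)
proof (induction V arbitrary: D rule: finite_induct)
  case empty
  have "c \<le> 0" if cv: "(c, v) \<in> D" for c v
  proof -
    have "v = (\<lambda>i. 0)" using empty(3)[OF cv] by auto
    then show ?thesis using const cv empty(2) by auto
  qed
  then show ?case by auto
next
  case (insert x V)
  \<comment> \<open>the combination of two inequalities that eliminates \<open>x\<close>; both multipliers are positive if \<open>v x > 0 > w x\<close>\<close>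
  define comb :: "(real \<times> ('n \<Rightarrow> int)) \<times> (real \<times> ('n \<Rightarrow> int)) \<Rightarrow> real \<times> ('n \<Rightarrow> int)"
    where "comb = (\<lambda>((c, v), (d, w)). (of_int (- w x) * c + of_int (v x) * d,
      \<lambda>i. - w x * v i + v x * w i))"
  define Dz where "Dz = {e \<in> D. snd e x = 0}"
  define Dp where "Dp = {e \<in> D. snd e x > 0}"
  define Dn where "Dn = {e \<in> D. snd e x < 0}"
  have "\<exists>a. \<forall>(c, v)\<in>Dz \<union> comb ` (Dp \<times> Dn). c + (\<Sum>i\<in>V. of_int (v i) * a i) \<le> 0"
  proof (rule insert.IH)
    show "finite (Dz \<union> comb ` (Dp \<times> Dn))"
      using insert.prems(1) by (auto simp: Dz_def Dp_def Dn_def)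
    have "comb ((c, v), (d, w)) \<in> K" if "(c, v) \<in> Dp" "(d, w) \<in> Dn" for c v d w
    proof -
      have 1: "(of_int (- w x) * c, \<lambda>i. - w x * v i) \<in> K"
        by (rule additive_set_multiple[OF add])
          (use that insert.prems(2) in \<open>auto simp: Dp_def Dn_def\<close>)
      have 2: "(of_int (v x) * d, \<lambda>i. v x * w i) \<in> K"
        by (rule additive_set_multiple[OF add])
          (use that insert.prems(2) in \<open>auto simp: Dp_def Dn_def\<close>)
      show ?thesis unfolding comb_def using add[OF 1 2] by simp
    qed
    then show "Dz \<union> comb ` (Dp \<times> Dn) \<subseteq> K"
      using insert.prems(2) by (auto simp: Dz_def)
    show "v i = 0" if cv: "(c, v) \<in> Dz \<union> comb ` (Dp \<times> Dn)" and i: "i \<notin> V" for c v i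
    proof (cases "i = x")
      case True
      then show ?thesis using cv by (auto simp: Dz_def comb_def)
    next
      case False
      then have zero: "w i = 0" if "(d, w) \<in> D" for d w
        using insert.prems(3)[OF that] i by auto
      show ?thesis using cv by (auto simp: Dz_def Dp_def Dn_def comb_def dest!: zero)
    qed
  qed
  then obtain a where a: "\<And>c v. (c, v) \<in> Dz \<union> comb ` (Dp \<times> Dn) \<Longrightarrow>
      c + (\<Sum>i\<in>V. of_int (v i) * a i) \<le> 0" by blast
  define r where "r = (\<lambda>(c, v). c + (\<Sum>i\<in>V. of_int (v i) * a i))"
  \<comment> \<open>the bound on \<open>x\<close> expressed by the inequality \<open>e\<close>, an upper one for \<open>Dp\<close> and a lower one for \<open>Dn\<close>\<close>
  define b where "b = (\<lambda>e. - r e / of_int (snd e x))"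
  have "\<exists>t. (\<forall>l\<in>b ` Dn. l \<le> t) \<and> (\<forall>u\<in>b ` Dp. t \<le> u)"
  proof (rule between_finite_sets)
    show "finite (b ` Dn)" "finite (b ` Dp)"
      using insert.prems(1) by (auto simp: Dn_def Dp_def)
    fix l u assume "l \<in> b ` Dn" "u \<in> b ` Dp"
    then obtain c v d w where cv: "(c, v) \<in> Dp" "u = b (c, v)" and dw: "(d, w) \<in> Dn" "l = b (d, w)"
      by auto
    have vx: "v x > 0" "w x < 0" using cv dw by (auto simp: Dp_def Dn_def)
    have "comb ((c, v), (d, w)) \<in> comb ` (Dp \<times> Dn)" using cv dw by blast
    then have "of_int (- w x) * c + of_int (v x) * d +
        (\<Sum>i\<in>V. of_int (- w x * v i + v x * w i) * a i) \<le> 0"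
      using a[of "fst (comb ((c, v), (d, w)))" "snd (comb ((c, v), (d, w)))"]
      by (simp add: comb_def)
    also have "(\<Sum>i\<in>V. of_int (- w x * v i + v x * w i) * a i) =
        of_int (- w x) * (\<Sum>i\<in>V. of_int (v i) * a i) + of_int (v x) * (\<Sum>i\<in>V. of_int (w i) * a i)"
      unfolding sum_distrib_left sum.distrib[symmetric]
      by (intro sum.cong) (auto simp: algebra_simps)
    finally have "of_int (v x) * r (d, w) \<le> of_int (w x) * r (c, v)"
      by (simp add: r_def algebra_simps)
    then show "l \<le> u"
      using vx by (simp add: cv dw b_def field_simps)
  qed
  then obtain t where tn: "\<And>e. e \<in> Dn \<Longrightarrow> b e \<le> t" and tp: "\<And>e. e \<in> Dp \<Longrightarrow> t \<le> b e"
    by blast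
  have "c + (\<Sum>i\<in>insert x V. of_int (v i) * (a(x := t)) i) \<le> 0" if cv: "(c, v) \<in> D" for c v
  proof -
    have "(\<Sum>i\<in>V. of_int (v i) * (a(x := t)) i) = (\<Sum>i\<in>V. of_int (v i) * a i)"
      using insert.hyps by (intro sum.cong) auto
    then have eq: "c + (\<Sum>i\<in>insert x V. of_int (v i) * (a(x := t)) i) = r (c, v) + of_int (v x) * t"
      using insert.hyps by (simp add: r_def)
    consider "v x = 0" | "v x > 0" | "v x < 0" by linarith
    then have "r (c, v) + of_int (v x) * t \<le> 0"
    proof cases
      case 1
      then show ?thesis using a[of c v] cv by (simp add: Dz_def r_def)
    next
      case 2
      then show ?thesis using tp[of "(c, v)"] cv by (simp add: Dp_def b_def field_simps)
    next
      case 3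
      then show ?thesis using tn[of "(c, v)"] cv by (simp add: Dn_def b_def field_simps)
    qed
    then show ?thesis using eq by simp
  qed
  then show ?case by (intro exI[of _ "a(x := t)"]) auto
qed

section \<open>Tropical preorders\<close>

text \<open>
  A monomial is the pair of its real coefficient and its exponent vector, and a finite tropical
  polynomial is the set of its monomials. The tropical sum of two polynomials is the union, and their
  tropical product is the elementwise sum \<open>U + V\<close> of the two sets. A set may contain several monomials with
  the same exponent vector; the minimum is unaffected by this.
\<close>

type_synonym 'n trop_monom = "real \<times> (nat ^ 'n)"

primrec trop_power :: "'a::comm_monoid_add set \<Rightarrow> nat \<Rightarrow> 'a set" where
  "trop_power A 0 = 0"
| "trop_power A (Suc k) = A + trop_power A k"

lemma trop_power_add: "trop_power A (k + l) = trop_power A k + trop_power A l"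
  by (induction k) (simp_all add: add.assoc)

lemma trop_power_mono: "A \<subseteq> B \<Longrightarrow> trop_power A k \<subseteq> trop_power B k"
  by (induction k) (simp_all add: set_plus_mono2)

lemma finite_trop_power: "finite A \<Longrightarrow> finite (trop_power A k)"
  by (induction k) (simp_all add: finite_set_plus)

lemma trop_power_nonempty: "A \<noteq> {} \<Longrightarrow> trop_power A k \<noteq> {}"
  by (induction k) (auto simp: set_plus_def)

lemma trop_power_pair:
  assumes "x \<in> trop_power {p, q} m"
  shows "\<exists>i j. i + j = m \<and> x \<in> trop_power {p} i + trop_power {q} j"
  using assms
proof (induction m arbitrary: x)
  case 0
  then show ?case by auto
next
  case (Suc m)
  then obtain r z where x: "x = r + z" and r: "r = p \<or> r = q" and z: "z \<in> trop_power {p, q} m"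
    by (auto elim!: set_plus_elim)
  obtain i j where ij: "i + j = m" "z \<in> trop_power {p} i + trop_power {q} j"
    using Suc.IH[OF z] by blast
  have "x \<in> {r} + (trop_power {p} i + trop_power {q} j)"
    unfolding x using ij(2) by blast
  then have "x \<in> trop_power {p} (Suc i) + trop_power {q} j \<or> x \<in> trop_power {p} i + trop_power {q} (Suc j)"
    using r by (auto simp: add_ac)
  then show ?case
    using ij(1) by (metis add_Suc add_Suc_right)
qed

text \<open>
  The idempotent binomial identity \<open>(p \<oplus> q)\<^bsup>2k\<^esup> = (p\<^sup>k \<oplus> q\<^sup>k) (p \<oplus> q)\<^sup>k\<close>: of two exponents with
  sum \<open>2k\<close>, one is at least \<open>k\<close>.
\<close>

lemma trop_power_pair_double:
  "trop_power {p, q} (k + k) \<subseteq> (trop_power {p} k \<union> trop_power {q} k) + trop_power {p, q} k"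
proof
  fix x assume "x \<in> trop_power {p, q} (k + k)"
  then obtain i j where ij: "i + j = k + k" and x: "x \<in> trop_power {p} i + trop_power {q} j"
    using trop_power_pair by blast
  have sub: "trop_power {p} a \<subseteq> trop_power {p, q} a" "trop_power {q} a \<subseteq> trop_power {p, q} a" for a
    by (intro trop_power_mono; simp)+
  show "x \<in> (trop_power {p} k \<union> trop_power {q} k) + trop_power {p, q} k"
  proof (cases "k \<le> i")
    case True
    then have "trop_power {p} i = trop_power {p} k + trop_power {p} (i - k)"
      by (simp flip: trop_power_add)
    then have "trop_power {p} i + trop_power {q} j = trop_power {p} k + (trop_power {p} (i - k) + trop_power {q} j)"
      by (simp add: add_ac)
    also have "\<dots> \<subseteq> (trop_power {p} k \<union> trop_power {q} k) + (trop_power {p, q} (i - k) + trop_power {p, q} j)"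
      by (intro set_plus_mono2 sub) auto
    also have "trop_power {p, q} (i - k) + trop_power {p, q} j = trop_power {p, q} k"
      using True ij by (simp flip: trop_power_add)
    finally show ?thesis using x by blast
  next
    case False
    then have "k \<le> j" using ij by simp
    then have "trop_power {q} j = trop_power {q} k + trop_power {q} (j - k)"
      by (simp flip: trop_power_add)
    then have "trop_power {p} i + trop_power {q} j = trop_power {q} k + (trop_power {p} i + trop_power {q} (j - k))"
      by (simp add: add_ac)
    also have "\<dots> \<subseteq> (trop_power {p} k \<union> trop_power {q} k) + (trop_power {p, q} i + trop_power {p, q} (j - k))"
      by (intro set_plus_mono2 sub) auto
    also have "trop_power {p, q} i + trop_power {p, q} (j - k) = trop_power {p, q} k"
      using \<open>k \<le> j\<close> ij by (simp flip: trop_power_add)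
    finally show ?thesis using x by blast
  qed
qed

text \<open>
  The axioms describe the order which polynomials inherit from a lattice-ordered abelian group into
  which they are mapped by a semiring homomorphism: \<open>superset\<close> and \<open>union\<close> make the tropical sum an
  infimum, \<open>cancel\<close> holds as products are taken in a group, and \<open>const\<close> says that
  the real constants are not collapsed.
\<close>

locale trop_preorder =
  fixes le :: "'n::finite trop_monom set \<Rightarrow> 'n trop_monom set \<Rightarrow> bool"  (infix "\<sqsubseteq>" 50)
  assumes superset: "V \<subseteq> U \<Longrightarrow> U \<sqsubseteq> V"
    and trans [trans]: "U \<sqsubseteq> V \<Longrightarrow> V \<sqsubseteq> W \<Longrightarrow> U \<sqsubseteq> W"
    and add_right: "U \<sqsubseteq> V \<Longrightarrow> U + H \<sqsubseteq> V + H"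
    and cancel: "U + H \<sqsubseteq> V + H \<Longrightarrow> finite H \<Longrightarrow> H \<noteq> {} \<Longrightarrow> U \<sqsubseteq> V"
    and union: "W \<sqsubseteq> U \<Longrightarrow> W \<sqsubseteq> V \<Longrightarrow> W \<sqsubseteq> U \<union> V"
    and const_mono: "c \<le> d \<Longrightarrow> {(c, 0)} \<sqsubseteq> {(d, 0)}"
    and const: "{(c, 0)} + U \<sqsubseteq> U \<Longrightarrow> finite U \<Longrightarrow> U \<noteq> {} \<Longrightarrow> c \<le> 0"

text \<open>
  The preorder generated by \<open>le\<close> and \<open>p \<le> q\<close>. In a lattice-ordered group, imposing \<open>p \<le> q\<close> means
  dividing by the convex subgroup generated by the element \<open>p - min p q\<close>, so \<open>U \<le> V\<close> holds in the
  quotient if and only if \<open>U \<le> V + k (p - min p q)\<close> for some \<open>k\<close>. The definition is this condition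
  without subtraction.
\<close>

definition adjoin ::
  "('n trop_monom set \<Rightarrow> 'n trop_monom set \<Rightarrow> bool) \<Rightarrow> 'n trop_monom \<Rightarrow> 'n trop_monom \<Rightarrow>
    'n::finite trop_monom set \<Rightarrow> 'n trop_monom set \<Rightarrow> bool" where
  "adjoin le p q U V \<longleftrightarrow> (\<exists>k. le (U + trop_power {p, q} k) (V + trop_power {p} k))"

context trop_preorder
begin

lemma add_left: "U \<sqsubseteq> V \<Longrightarrow> H + U \<sqsubseteq> H + V"
  using add_right[of U V H] by (simp add: add.commute)

lemma add_mono: "U \<sqsubseteq> V \<Longrightarrow> U' \<sqsubseteq> V' \<Longrightarrow> U + U' \<sqsubseteq> V + V'"
  by (rule trans[OF add_right add_left])

lemma trop_power_le: "trop_power {p, q} k \<sqsubseteq> trop_power {p} k"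
  by (intro superset trop_power_mono) auto

lemma adjoin_raise:
  assumes "U + trop_power {p, q} k \<sqsubseteq> V + trop_power {p} k" and "k \<le> l"
  shows "U + trop_power {p, q} l \<sqsubseteq> V + trop_power {p} l"
proof -
  have "(U + trop_power {p, q} k) + trop_power {p, q} (l - k) \<sqsubseteq> (V + trop_power {p} k) + trop_power {p} (l - k)"
    using assms(1) trop_power_le by (rule add_mono)
  then show ?thesis
    using assms(2) trop_power_add[of "{p, q}" k "l - k"] trop_power_add[of "{p}" k "l - k"]
    by (simp add: add.assoc)
qed

lemma adjoin_extends: "U \<sqsubseteq> V \<Longrightarrow> adjoin (\<sqsubseteq>) p q U V"
  unfolding adjoin_def by (rule exI[of _ 0]) simp

lemma adjoin_new: "adjoin (\<sqsubseteq>) p q {p} {q}"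
  unfolding adjoin_def
  by (rule exI[of _ 1], rule superset) (simp add: add.commute[of "{q}"] set_plus_mono2)

text \<open>
  The exponents \<open>k\<close> of two comparisons are reconciled by adding them, for transitivity, or by raising both
  to their maximum, for the infimum.
\<close>

lemma trop_preorder_adjoin:
  assumes const': "\<And>c U. adjoin (\<sqsubseteq>) p q ({(c, 0)} + U) U \<Longrightarrow> finite U \<Longrightarrow> U \<noteq> {} \<Longrightarrow> c \<le> 0"
  shows "trop_preorder (adjoin (\<sqsubseteq>) p q)"
proof
  fix U V :: "'n trop_monom set" assume "V \<subseteq> U"
  then show "adjoin (\<sqsubseteq>) p q U V" by (intro adjoin_extends superset)
next
  fix U V W :: "'n trop_monom set"
  assume "adjoin (\<sqsubseteq>) p q U V" "adjoin (\<sqsubseteq>) p q V W"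
  then obtain k l where k: "U + trop_power {p, q} k \<sqsubseteq> V + trop_power {p} k"
    and l: "V + trop_power {p, q} l \<sqsubseteq> W + trop_power {p} l"
    unfolding adjoin_def by blast
  have "(U + trop_power {p, q} k) + trop_power {p, q} l \<sqsubseteq> (V + trop_power {p} k) + trop_power {p, q} l"
    using k by (rule add_right)
  also have "\<dots> = (V + trop_power {p, q} l) + trop_power {p} k" by (simp add: add_ac)
  also have "\<dots> \<sqsubseteq> (W + trop_power {p} l) + trop_power {p} k"
    using l by (rule add_right)
  finally have "U + trop_power {p, q} (k + l) \<sqsubseteq> W + trop_power {p} (k + l)"
    by (simp add: trop_power_add add_ac)
  then show "adjoin (\<sqsubseteq>) p q U W" unfolding adjoin_def by blast
next
  fix U V H :: "'n trop_monom set"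
  assume "adjoin (\<sqsubseteq>) p q U V"
  then obtain k where "U + trop_power {p, q} k \<sqsubseteq> V + trop_power {p} k" unfolding adjoin_def by blast
  then have "(U + trop_power {p, q} k) + H \<sqsubseteq> (V + trop_power {p} k) + H" by (rule add_right)
  then have "(U + H) + trop_power {p, q} k \<sqsubseteq> (V + H) + trop_power {p} k" by (simp add: add_ac)
  then show "adjoin (\<sqsubseteq>) p q (U + H) (V + H)" unfolding adjoin_def by blast
next
  fix U V H :: "'n trop_monom set"
  assume "adjoin (\<sqsubseteq>) p q (U + H) (V + H)" and H: "finite H" "H \<noteq> {}"
  then obtain k where "(U + H) + trop_power {p, q} k \<sqsubseteq> (V + H) + trop_power {p} k"
    unfolding adjoin_def by blast
  then have "(U + trop_power {p, q} k) + H \<sqsubseteq> (V + trop_power {p} k) + H" by (simp add: add_ac)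
  then have "U + trop_power {p, q} k \<sqsubseteq> V + trop_power {p} k" using H by (rule cancel)
  then show "adjoin (\<sqsubseteq>) p q U V" unfolding adjoin_def by blast
next
  fix U V W :: "'n trop_monom set"
  assume "adjoin (\<sqsubseteq>) p q W U" "adjoin (\<sqsubseteq>) p q W V"
  then obtain k l where "W + trop_power {p, q} k \<sqsubseteq> U + trop_power {p} k"
    and "W + trop_power {p, q} l \<sqsubseteq> V + trop_power {p} l"
    unfolding adjoin_def by blast
  then have "W + trop_power {p, q} (max k l) \<sqsubseteq> U + trop_power {p} (max k l)"
    "W + trop_power {p, q} (max k l) \<sqsubseteq> V + trop_power {p} (max k l)"
    by (auto intro: adjoin_raise)
  then have "W + trop_power {p, q} (max k l) \<sqsubseteq> (U \<union> V) + trop_power {p} (max k l)"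
    unfolding Un_set_plus by (rule union)
  then show "adjoin (\<sqsubseteq>) p q W (U \<union> V)" unfolding adjoin_def by blast
next
  fix c d :: real assume "c \<le> d"
  then show "adjoin (\<sqsubseteq>) p q {(c, 0)} {(d, 0)}" by (intro adjoin_extends const_mono)
next
  fix c and U :: "'n trop_monom set"
  assume "adjoin (\<sqsubseteq>) p q ({(c, 0)} + U) U" "finite U" "U \<noteq> {}"
  then show "c \<le> 0" by (rule const')
qed

lemma not_trop_preorder_adjoin:
  assumes "\<not> trop_preorder (adjoin (\<sqsubseteq>) p q)"
  shows "\<exists>c k. c > 0 \<and> {(c, 0)} + trop_power {p, q} k \<sqsubseteq> trop_power {p} k"
proof -
  obtain c U where c: "c > 0" and U: "finite U" "U \<noteq> {}"
    and "adjoin (\<sqsubseteq>) p q ({(c, 0)} + U) U"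
    using contrapos_nn[OF assms trop_preorder_adjoin] by (meson not_le)
  then obtain k where "({(c, 0)} + U) + trop_power {p, q} k \<sqsubseteq> U + trop_power {p} k"
    unfolding adjoin_def by blast
  then have "({(c, 0)} + trop_power {p, q} k) + U \<sqsubseteq> trop_power {p} k + U"
    by (simp add: add_ac)
  then have "{(c, 0)} + trop_power {p, q} k \<sqsubseteq> trop_power {p} k" using U by (rule cancel)
  then show ?thesis using c by blast
qed

text \<open>
  The elements \<open>p - min p q\<close> and \<open>q - min p q\<close> have the infimum \<open>0\<close>, and so have any multiples of
  them. If both \<open>p \<le> q\<close> and \<open>q \<le> p\<close> collapsed the constants, then some positive constant \<open>e\<close> would lie
  below a multiple of each, so \<open>e \<le> 0\<close>.
\<close>

lemma adjoin_dichotomy: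
  "trop_preorder (adjoin (\<sqsubseteq>) p q) \<or> trop_preorder (adjoin (\<sqsubseteq>) q p)"
proof (rule ccontr)
  assume neg: "\<not> ?thesis"
  obtain c k where c: "c > 0" "{(c, 0)} + trop_power {p, q} k \<sqsubseteq> trop_power {p} k"
    using not_trop_preorder_adjoin[of p q] neg by auto
  obtain d l where d: "d > 0" "{(d, 0)} + trop_power {p, q} l \<sqsubseteq> trop_power {q} l"
    using not_trop_preorder_adjoin[of q p] neg by (auto simp: insert_commute[of q p])
  define m e where "m = max k l" and "e = min c d"
  have raise: "{(e, 0)} + trop_power {p, q} m \<sqsubseteq> trop_power {r} m"
    if "{(b, 0)} + trop_power {p, q} j \<sqsubseteq> trop_power {r} j" "e \<le> b" "j \<le> m" "r \<in> {p, q}" for b j r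
  proof -
    have "{(e, 0)} + trop_power {p, q} m = {(e, 0)} + (trop_power {p, q} j + trop_power {p, q} (m - j))"
      using that(3) by (simp flip: trop_power_add)
    also have "\<dots> \<sqsubseteq> {(b, 0)} + (trop_power {p, q} j + trop_power {p, q} (m - j))"
      by (intro add_right const_mono that)
    also have "\<dots> = ({(b, 0)} + trop_power {p, q} j) + trop_power {p, q} (m - j)"
      by (simp add: add.assoc)
    also have "\<dots> \<sqsubseteq> trop_power {r} j + trop_power {r} (m - j)"
      using that(1) by (rule add_mono) (use that(4) in \<open>intro superset trop_power_mono, auto\<close>)
    also have "\<dots> = trop_power {r} m" using that(3) by (simp flip: trop_power_add)
    finally show ?thesis .
  qed
  have "{(e, 0)} + trop_power {p, q} m \<sqsubseteq> trop_power {p} m \<union> trop_power {q} m"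
    using raise[OF c(2)] raise[OF d(2)] by (intro union) (auto simp: m_def e_def)
  then have "{(e, 0)} + trop_power {p, q} m + trop_power {p, q} m
      \<sqsubseteq> (trop_power {p} m \<union> trop_power {q} m) + trop_power {p, q} m"
    by (rule add_right)
  also have "\<dots> \<sqsubseteq> trop_power {p, q} (m + m)"
    by (intro superset trop_power_pair_double)
  finally have "{(e, 0)} + trop_power {p, q} (m + m) \<sqsubseteq> trop_power {p, q} (m + m)"
    by (simp add: trop_power_add add.assoc)
  then have "e \<le> 0"
    by (rule const) (auto intro: finite_trop_power simp: trop_power_nonempty)
  then show False using c(1) d(1) by (simp add: e_def)
qed

end

lemma total_extension:
  assumes "trop_preorder le" and "finite Q"
  shows "\<exists>le'. trop_preorder le' \<and> (\<forall>U V. le U V \<longrightarrow> le' U V) \<and>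
    (\<forall>(p, q)\<in>Q. le' {p} {q} \<or> le' {q} {p})"
  using assms(2)
proof (induction Q rule: finite_induct)
  case empty
  then show ?case using assms(1) by auto
next
  case (insert x Q)
  obtain p q where x: "x = (p, q)" by (cases x)
  obtain le1 where le1: "trop_preorder le1" "\<And>U V. le U V \<Longrightarrow> le1 U V"
    "\<And>p q. (p, q) \<in> Q \<Longrightarrow> le1 {p} {q} \<or> le1 {q} {p}"
    using insert.IH by blast
  interpret trop_preorder le1 by fact
  have step: ?case if "trop_preorder (adjoin le1 r s)" and rs: "r = p \<and> s = q \<or> r = q \<and> s = p" for r s
  proof (intro exI[of _ "adjoin le1 r s"] conjI allI impI ballI)
    show "trop_preorder (adjoin le1 r s)" by fact
    show "adjoin le1 r s U V" if "le U V" for U V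
      using le1(2)[OF that] by (rule adjoin_extends)
    fix e assume e: "e \<in> insert x Q"
    obtain p' q' where pq: "e = (p', q')" by (cases e)
    have "adjoin le1 r s {p'} {q'} \<or> adjoin le1 r s {q'} {p'}"
    proof (cases "e = x")
      case True
      then show ?thesis using pq x rs adjoin_new[of r s] by auto
    next
      case False
      then have "le1 {p'} {q'} \<or> le1 {q'} {p'}" using e pq le1(3) by blast
      then show ?thesis using adjoin_extends by blast
    qed
    then show "case e of (p, q) \<Rightarrow> adjoin le1 r s {p} {q} \<or> adjoin le1 r s {q} {p}"
      by (simp add: pq)
  qed
  show ?case using adjoin_dichotomy[of p q] step[of p q] step[of q p] by auto
qed

definition monom_at :: "('n \<Rightarrow> real) \<Rightarrow> 'n::finite trop_monom \<Rightarrow> real" where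
  "monom_at a e = fst e + (\<Sum>i\<in>UNIV. real (snd e $ i) * a i)"

text \<open>
  Sums of valid comparisons of monomials are valid, and no positive constant is \<open>\<le> 0\<close>. This is what Fourier-Motzkin elimination requires.
\<close>

lemma (in trop_preorder) real_point:
  assumes "finite X"
  shows "\<exists>a. \<forall>p\<in>X. \<forall>q\<in>X. {p} \<sqsubseteq> {q} \<longrightarrow> monom_at a p \<le> monom_at a q"
proof -
  define diff :: "'n trop_monom \<times> 'n trop_monom \<Rightarrow> real \<times> ('n \<Rightarrow> int)"
    where "diff = (\<lambda>(p, q). (fst p - fst q, \<lambda>i. int (snd p $ i) - int (snd q $ i)))"
  define K where "K = diff ` {(p, q). {p} \<sqsubseteq> {q}}"
  have "\<exists>a. \<forall>(c, v)\<in>diff ` {(p, q) \<in> X \<times> X. {p} \<sqsubseteq> {q}}. c + (\<Sum>i\<in>UNIV. of_int (v i) * a i) \<le> 0"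
  proof (rule fourier_motzkin)
    fix c v d w assume "(c, v) \<in> K" "(d, w) \<in> K"
    then obtain p q p' q' where 1: "(c, v) = diff (p, q)" "{p} \<sqsubseteq> {q}"
      and 2: "(d, w) = diff (p', q')" "{p'} \<sqsubseteq> {q'}"
      by (auto simp: K_def)
    have "{p + p'} \<sqsubseteq> {q + q'}" using add_mono[OF 1(2) 2(2)] by (simp add: set_plus_def)
    moreover have "(c + d, \<lambda>i. v i + w i) = diff (p + p', q + q')"
      using 1(1) 2(1) by (auto simp: diff_def)
    ultimately show "(c + d, \<lambda>i. v i + w i) \<in> K" unfolding K_def by blast
  next
    fix c assume "(c, \<lambda>i. 0) \<in> K"
    then obtain p q where d: "(c, \<lambda>i. 0) = diff (p, q)" and le: "{p} \<sqsubseteq> {q}"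
      by (auto simp: K_def)
    have "snd p = snd q" "fst p = c + fst q"
      using d by (auto simp: diff_def vec_eq_iff fun_eq_iff)
    then have "{p} = {(c, 0)} + {q}" by (auto simp: set_plus_def prod_eq_iff)
    then show "c \<le> 0" using const[of c "{q}"] le by simp
  next
    show "finite (diff ` {(p, q) \<in> X \<times> X. {p} \<sqsubseteq> {q}})"
      by (rule finite_imageI, rule finite_subset[of _ "X \<times> X"]) (use assms in auto)
  qed (auto simp: K_def)
  then obtain a where a: "\<forall>(c, v)\<in>diff ` {(p, q) \<in> X \<times> X. {p} \<sqsubseteq> {q}}.
      c + (\<Sum>i\<in>UNIV. of_int (v i) * a i) \<le> 0" ..
  have "monom_at a p \<le> monom_at a q" if "p \<in> X" "q \<in> X" "{p} \<sqsubseteq> {q}" for p q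
  proof -
    have "diff (p, q) \<in> diff ` {(p, q) \<in> X \<times> X. {p} \<sqsubseteq> {q}}" using that by blast
    then have "case diff (p, q) of (c, v) \<Rightarrow> c + (\<Sum>i\<in>UNIV. of_int (v i) * a i) \<le> 0"
      by (rule bspec[OF a])
    then have "fst p - fst q + (\<Sum>i\<in>UNIV. of_int (int (snd p $ i) - int (snd q $ i)) * a i) \<le> 0"
      by (simp only: diff_def prod.case)
    then show ?thesis by (simp add: monom_at_def left_diff_distrib sum_subtractf)
  qed
  then show ?thesis by blast
qed

text \<open>
  After making the order total on the finitely many monomials involved, a real point that preserves
  this order evaluates each polynomial by its least monomial, and equivalent polynomials have
  equivalent least monomials.
\<close>

lemma (in trop_preorder) common_point:
  assumes "finite \<F>" and fin: "\<And>U V. (U, V) \<in> \<F> \<Longrightarrow> finite U \<and> finite V \<and> U \<noteq> {} \<and> V \<noteq> {}"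
    and le: "\<And>U V. (U, V) \<in> \<F> \<Longrightarrow> U \<sqsubseteq> V \<and> V \<sqsubseteq> U"
  shows "\<exists>a. \<forall>(U, V)\<in>\<F>. Min (monom_at a ` U) = Min (monom_at a ` V)"
proof -
  define X where "X = (\<Union>(U, V)\<in>\<F>. U \<union> V)"
  have "finite X" using assms(1) fin by (auto simp: X_def)
  obtain le' where "trop_preorder le'" and ext: "\<And>U V. U \<sqsubseteq> V \<Longrightarrow> le' U V"
    and total: "\<And>p q. p \<in> X \<Longrightarrow> q \<in> X \<Longrightarrow> le' {p} {q} \<or> le' {q} {p}"
    using total_extension[OF trop_preorder_axioms, of "X \<times> X"] \<open>finite X\<close> by auto
  interpret E: trop_preorder le' by fact
  obtain a where a: "\<And>p q. p \<in> X \<Longrightarrow> q \<in> X \<Longrightarrow> le' {p} {q} \<Longrightarrow> monom_at a p \<le> monom_at a q"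
    using E.real_point[OF \<open>finite X\<close>] by blast
  have least: "\<exists>p\<in>U. le' {p} U" if "finite U" "U \<noteq> {}" "U \<subseteq> X" for U
    using that
  proof (induction U rule: finite_ne_induct)
    case (singleton x)
    then show ?case using E.superset by blast
  next
    case (insert x U)
    then obtain p where p: "p \<in> U" "le' {p} U" by auto
    have "le' {p} {x} \<or> le' {x} {p}" using total insert.prems p(1) by blast
    then show ?case
    proof
      assume "le' {p} {x}"
      then show ?case using E.union[of "{p}" "{x}" U] p by auto
    next
      assume "le' {x} {p}"
      then have "le' {x} U" using p(2) E.trans by blast
      then show ?case using E.union[of "{x}" "{x}" U] E.superset[of "{x}" "{x}"] by auto
    qed
  qed
  have Min_le: "Min (monom_at a ` U) \<le> Min (monom_at a ` V)"
    if U: "finite U" "U \<noteq> {}" "U \<subseteq> X" and V: "finite V" "V \<noteq> {}" "V \<subseteq> X" and UV: "U \<sqsubseteq> V" for U V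
  proof -
    obtain p where p: "p \<in> U" "le' {p} U" using least[OF U] by blast
    have "monom_at a p \<le> monom_at a q" if "q \<in> V" for q
    proof -
      have "le' {p} V" using p(2) ext[OF UV] E.trans by blast
      then have "le' {p} {q}" using E.superset[of "{q}" V] that E.trans by blast
      then show ?thesis using a p(1) that U(3) V(3) by blast
    qed
    moreover have "Min (monom_at a ` U) \<le> monom_at a p" using U(1) p(1) by simp
    ultimately show ?thesis using V(1,2) by (auto simp: Min_ge_iff intro: order_trans)
  qed
  have "Min (monom_at a ` U) = Min (monom_at a ` V)" if "(U, V) \<in> \<F>" for U V
    using that fin[OF that] le[OF that]
    by (intro antisym Min_le) (auto simp: X_def)
  then show ?thesis by auto
qed

section \<open>The preorder of a tropically linear functional\<close>

definition pairing :: "(nat ^ 'n \<Rightarrow> ereal) \<Rightarrow> 'n::finite trop_monom set \<Rightarrow> ereal" where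
  "pairing y U = (INF e\<in>U. ereal (fst e) + y (snd e))"

lemma ereal_add_le_iff_real: "ereal r + a \<le> b \<longleftrightarrow> a \<le> ereal (- r) + b"
  by (cases a; cases b) auto

lemma INF_add_real: "(INF x\<in>A. ereal r + f x) = ereal r + (INF x\<in>A. f x)"
proof (rule antisym)
  have "ereal (- r) + (INF x\<in>A. ereal r + f x) \<le> f x" if "x \<in> A" for x
    using INF_lower[OF that, of "\<lambda>x. ereal r + f x"] by (simp add: ereal_add_le_iff_real)
  then have "ereal (- r) + (INF x\<in>A. ereal r + f x) \<le> (INF x\<in>A. f x)"
    by (rule INF_greatest)
  then show "(INF x\<in>A. ereal r + f x) \<le> ereal r + (INF x\<in>A. f x)"
    using ereal_add_le_iff_real[of "- r"] by simp
  show "ereal r + (INF x\<in>A. f x) \<le> (INF x\<in>A. ereal r + f x)"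
    by (intro INF_greatest add_left_mono INF_lower)
qed

lemma pairing_plus: "pairing y (U + S) = (INF s\<in>S. pairing y (U + {s}))"
proof -
  have "U + S = (\<Union>s\<in>S. U + {s})" by (auto simp: set_plus_def)
  then show ?thesis
    unfolding pairing_def by (auto intro!: antisym INF_greatest intro: INF_lower2 INF_lower)
qed

lemma pairing_const: "pairing y ({(c, 0)} + U) = ereal c + pairing y U"
proof -
  have eq: "{(c, 0)} + U = (\<lambda>e. (c, 0) + e) ` U" by (auto simp: set_plus_def)
  show ?thesis
    unfolding pairing_def eq image_image INF_add_real[symmetric]
    by (simp add: add.assoc flip: plus_ereal.simps)
qed

lemma pairing_finite:
  assumes "finite U" "U \<noteq> {}" "\<And>I. y I \<noteq> -\<infinity>" "e \<in> U" "y (snd e) \<noteq> \<infinity>"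
  shows "\<exists>r. pairing y U = ereal r"
proof -
  have "pairing y U \<le> ereal (fst e) + y (snd e)"
    unfolding pairing_def using assms(4) by (rule INF_lower)
  moreover have "ereal (fst e) + y (snd e) \<noteq> \<infinity>" using assms(5) by simp
  moreover have "pairing y U \<in> (\<lambda>e. ereal (fst e) + y (snd e)) ` U"
    unfolding pairing_def using assms(1,2) by (simp add: cInf_eq_Min del: Min_in) (rule Min_in; simp)
  then have "pairing y U \<noteq> -\<infinity>" using assms(3) by auto
  ultimately show ?thesis by (cases "pairing y U") auto
qed

text \<open>
  The factor \<open>H\<close> builds cancellation into the preorder. The constants stay separated because \<open>y\<close> has
  finite values beyond any given exponent vector: then every polynomial has a shift at which the
  functional has a finite value \<open>r\<close>, and \<open>c + r \<le> r\<close> forces \<open>c \<le> 0\<close>.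
\<close>

lemma trop_preorder_pairing:
  fixes y :: "nat ^ 'n::finite \<Rightarrow> ereal"
  assumes y: "\<And>I. y I \<noteq> -\<infinity>" and cofinal: "\<And>J. \<exists>I. y (J + I) \<noteq> \<infinity>"
  shows "trop_preorder (\<lambda>U V. \<exists>H. finite H \<and> H \<noteq> {} \<and>
    (\<forall>S. pairing y (U + H + S) \<le> pairing y (V + H + S)))" (is "trop_preorder ?le")
proof
  fix U V :: "'n trop_monom set" assume "V \<subseteq> U"
  then have "pairing y (U + {0} + S) \<le> pairing y (V + {0} + S)" for S
    unfolding pairing_def by (intro INF_superset_mono set_plus_mono2) auto
  then show "?le U V" by (auto intro!: exI[of _ "{0}"])
next
  fix U V W :: "'n trop_monom set"
  assume "?le U V" "?le V W"
  then obtain H L where H: "finite H" "H \<noteq> {}" "\<And>S. pairing y (U + H + S) \<le> pairing y (V + H + S)"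
    and L: "finite L" "L \<noteq> {}" "\<And>S. pairing y (V + L + S) \<le> pairing y (W + L + S)"
    by blast
  have "pairing y (U + (H + L) + S) \<le> pairing y (W + (H + L) + S)" for S
    using order_trans[OF H(3)[of "L + S"]] L(3)[of "H + S"] by (simp add: add_ac)
  moreover have "finite (H + L)" "H + L \<noteq> {}"
    using H L by (auto simp: finite_set_plus)
  ultimately show "?le U W" by blast
next
  fix U V K :: "'n trop_monom set"
  assume "?le U V"
  then obtain H where H: "finite H" "H \<noteq> {}" "\<And>S. pairing y (U + H + S) \<le> pairing y (V + H + S)"
    by blast
  have "pairing y (U + K + H + S) \<le> pairing y (V + K + H + S)" for S
    using H(3)[of "K + S"] by (simp add: add_ac)
  then show "?le (U + K) (V + K)" using H(1,2) by blast
next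
  fix U V K :: "'n trop_monom set"
  assume K: "finite K" "K \<noteq> {}" and "?le (U + K) (V + K)"
  then obtain H where H: "finite H" "H \<noteq> {}"
    "\<And>S. pairing y (U + K + H + S) \<le> pairing y (V + K + H + S)"
    by blast
  then have "finite (K + H)" "K + H \<noteq> {}"
    using K by (auto simp: finite_set_plus)
  moreover have "pairing y (U + (K + H) + S) \<le> pairing y (V + (K + H) + S)" for S
    using H(3)[of S] by (simp add: add_ac)
  ultimately show "?le U V" by blast
next
  fix U V W :: "'n trop_monom set"
  assume "?le W U" "?le W V"
  then obtain H L where H: "finite H" "H \<noteq> {}" "\<And>S. pairing y (W + H + S) \<le> pairing y (U + H + S)"
    and L: "finite L" "L \<noteq> {}" "\<And>S. pairing y (W + L + S) \<le> pairing y (V + L + S)"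
    by blast
  have "pairing y (W + (H + L) + S) \<le> pairing y ((U \<union> V) + (H + L) + S)" for S
  proof -
    have "pairing y ((U \<union> V) + (H + L) + S) =
        inf (pairing y (U + (H + L) + S)) (pairing y (V + (H + L) + S))"
      unfolding Un_set_plus by (simp add: pairing_def INF_union)
    then show ?thesis
      using H(3)[of "L + S"] L(3)[of "H + S"] by (simp add: add_ac)
  qed
  moreover have "finite (H + L)" "H + L \<noteq> {}"
    using H L by (auto simp: finite_set_plus)
  ultimately show "?le W (U \<union> V)" by blast
next
  fix c d :: real assume "c \<le> d"
  then have "pairing y ({(c, 0)} + {0} + S) \<le> pairing y ({(d, 0)} + {0} + S)" for S
    by (simp add: pairing_const add_right_mono)
  then show "?le {(c, 0)} {(d, 0)}" by (auto intro!: exI[of _ "{0}"])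
next
  fix c and U :: "'n trop_monom set"
  assume "?le ({(c, 0)} + U) U" and U: "finite U" "U \<noteq> {}"
  then obtain H where H: "finite H" "H \<noteq> {}"
    "\<And>S. pairing y ({(c, 0)} + U + H + S) \<le> pairing y (U + H + S)"
    by blast
  obtain u h where uh: "u \<in> U" "h \<in> H" using U H by blast
  obtain I where I: "y (snd (u + h) + I) \<noteq> \<infinity>" using cofinal by blast
  let ?Z = "U + H + {(0, I)}"
  have "u + h + (0, I) \<in> ?Z" using uh by blast
  moreover have "finite ?Z" using U H by (simp add: finite_set_plus)
  ultimately obtain r where r: "pairing y ?Z = ereal r"
    using pairing_finite[of ?Z y "u + h + (0, I)"] y I by auto
  have "pairing y ({(c, 0)} + ?Z) \<le> pairing y ?Z" using H(3) by (simp add: add.assoc)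
  then show "c \<le> 0" by (simp add: pairing_const r)
qed

section \<open>Directions in which a set of exponents is unbounded\<close>

text \<open>
  \<open>W\<close> is a maximal set of coordinates such that \<open>S\<close> has points that are large in all coordinates from
  \<open>W\<close> simultaneously. By maximality, points of \<open>S\<close> that are sufficiently large on \<open>W\<close> have bounded coordinates
  outside \<open>W\<close>, so only finitely many outer parts occur arbitrarily far out. The shift \<open>B\<close> agrees
  outside \<open>W\<close> with one of these that has the largest coordinate sum, and on \<open>W\<close> with a vector beyond
  which all outer parts are among these; then a point of \<open>S\<close> above \<open>B\<close> has no room to grow outside \<open>W\<close>.
\<close>

lemma maximal_direction_of_set:
  fixes S :: "(nat ^ 'n::finite) set"
  assumes "S \<noteq> {}"
  shows "\<exists>W B. (\<forall>I i. I + B \<in> S \<longrightarrow> i \<notin> W \<longrightarrow> I $ i = 0) \<and>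
    (\<forall>J. \<exists>I. (\<forall>i\<in>W. J $ i \<le> I $ i) \<and> I + B \<in> S)"
proof -
  \<comment> \<open>the sets of directions in which \<open>S\<close> is simultaneously unbounded\<close>
  define unb where "unb = (\<lambda>W. \<forall>J. \<exists>I\<in>S. \<forall>i\<in>W. J $ i \<le> I $ i)"
  have "finite {W. unb W}" "{} \<in> {W. unb W}"
    using assms by (auto simp: unb_def)
  then obtain W where W: "unb W" and Wmax: "\<And>W'. unb W' \<Longrightarrow> W \<subseteq> W' \<Longrightarrow> W = W'"
    using finite_has_maximal2 by (metis mem_Collect_eq)
  have "\<exists>J. \<forall>I\<in>S. (\<forall>k\<in>W. J $ k \<le> I $ k) \<longrightarrow> I $ i < J $ i" if "i \<notin> W" for i
  proof -
    have "\<not> unb (insert i W)" using Wmax[of "insert i W"] that by blast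
    then obtain J where "\<forall>I\<in>S. \<exists>k\<in>insert i W. I $ k < J $ k"
      unfolding unb_def by (metis not_le)
    then show ?thesis by (metis insertE not_le)
  qed
  then obtain Jf where Jf: "\<And>i I. i \<notin> W \<Longrightarrow> I \<in> S \<Longrightarrow> (\<forall>k\<in>W. Jf i $ k \<le> I $ k) \<Longrightarrow> I $ i < Jf i $ i"
    by metis
  define M where "M = (\<Sum>i\<in>UNIV. Jf i)"
  have JfM: "Jf i $ k \<le> M $ k" for i k
    unfolding M_def sum_component by (rule member_le_sum) auto
  have bound: "I $ i < M $ i" if "I \<in> S" "\<forall>k\<in>W. M $ k \<le> I $ k" "i \<notin> W" for I i
    using Jf[of i I] JfM that by (meson le_trans less_le_trans)
  define out where "out = (\<lambda>I::nat^'n. \<chi> i. if i \<in> W then 0 else I $ i)"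
  define \<Lambda> where "\<Lambda> = {L::nat^'n. (\<forall>i. L $ i \<le> M $ i)}"
  have "\<Lambda> \<subseteq> vec_lambda ` (PiE UNIV (\<lambda>i. {..M $ i}))"
  proof
    fix L assume "L \<in> \<Lambda>"
    then have "vec_nth L \<in> PiE UNIV (\<lambda>i. {..M $ i})" by (auto simp: \<Lambda>_def)
    then show "L \<in> vec_lambda ` (PiE UNIV (\<lambda>i. {..M $ i}))"
      by (metis imageI vec_nth_inverse)
  qed
  moreover have "finite (PiE (UNIV::'n set) (\<lambda>i. {..M $ i}))"
    by (intro finite_PiE) auto
  ultimately have fin: "finite \<Lambda>" using finite_surj by blast
  \<comment> \<open>the outer parts \<open>L\<close> that occur arbitrarily far out in the directions of \<open>W\<close>\<close>
  define cof where "cof = (\<lambda>L. \<forall>J. \<exists>I\<in>S. (\<forall>i\<in>W. J $ i \<le> I $ i) \<and> out I = L)"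
  have "\<exists>J. \<forall>I\<in>S. (\<forall>i\<in>W. J $ i \<le> I $ i) \<longrightarrow> out I \<noteq> L" if "\<not> cof L" for L
    using that unfolding cof_def by blast
  then obtain Jc where Jc: "\<And>L I. \<not> cof L \<Longrightarrow> I \<in> S \<Longrightarrow> (\<forall>i\<in>W. Jc L $ i \<le> I $ i) \<Longrightarrow> out I \<noteq> L"
    by metis
  define N where "N = M + (\<Sum>L\<in>\<Lambda>. Jc L)"
  have JcN: "Jc L $ k \<le> N $ k" if "L \<in> \<Lambda>" for L k
  proof -
    have "Jc L $ k \<le> (\<Sum>L\<in>\<Lambda>. Jc L $ k)" using that fin by (intro member_le_sum) auto
    then show ?thesis by (simp add: N_def)
  qed
  have far: "out I \<in> \<Lambda> \<and> cof (out I)" if "I \<in> S" "\<forall>k\<in>W. N $ k \<le> I $ k" for I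
  proof -
    have "\<forall>k\<in>W. M $ k \<le> I $ k" using that(2) by (auto simp: N_def)
    then have "out I \<in> \<Lambda>" using bound[OF that(1)] by (auto simp: \<Lambda>_def out_def intro: less_imp_le)
    then show ?thesis using Jc[of "out I" I] JcN that le_trans by blast
  qed
  obtain I0 where I0: "I0 \<in> S" "\<forall>k\<in>W. N $ k \<le> I0 $ k" using W unfolding unb_def by blast
  define sz where "sz = (\<lambda>L::nat^'n. \<Sum>i\<in>UNIV. L $ i)"
  have fin': "finite (sz ` {L\<in>\<Lambda>. cof L})" using fin by simp
  have "out I0 \<in> {L\<in>\<Lambda>. cof L}" using far I0 by blast
  then have "Max (sz ` {L\<in>\<Lambda>. cof L}) \<in> sz ` {L\<in>\<Lambda>. cof L}"
    using fin' by (intro Max_in) auto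
  then obtain L where L: "L \<in> \<Lambda>" "cof L" and eq: "sz L = Max (sz ` {L\<in>\<Lambda>. cof L})"
    by auto
  have Lmax: "(\<Sum>i\<in>UNIV. L' $ i) \<le> (\<Sum>i\<in>UNIV. L $ i)" if "L' \<in> \<Lambda>" "cof L'" for L'
    using Max_ge[OF fin', of "sz L'"] that by (simp add: eq[symmetric]) (simp add: sz_def)
  obtain I1 where "out I1 = L" using L(2) unfolding cof_def by blast
  then have LW: "L $ i = 0" if "i \<in> W" for i using that by (auto simp: out_def)
  define B where "B = (\<chi> i. if i \<in> W then N $ i else L $ i)"
  show ?thesis
  proof (rule exI[of _ W], rule exI[of _ B], intro conjI allI impI)
    fix I i assume I: "I + B \<in> S" "i \<notin> W"
    have "out (I + B) \<in> \<Lambda> \<and> cof (out (I + B))" by (rule far) (use I in \<open>auto simp: B_def\<close>)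
    then have le: "(\<Sum>i\<in>UNIV. out (I + B) $ i) \<le> (\<Sum>i\<in>UNIV. L $ i)" using Lmax by blast
    have "out (I + B) = out I + L" using LW by (auto simp: out_def B_def vec_eq_iff)
    then have "(\<Sum>i\<in>UNIV. out I $ i) = 0" using le by (simp add: sum.distrib)
    then have "out I $ i = 0" by simp
    then show "I $ i = 0" using I(2) by (simp add: out_def)
  next
    fix J
    obtain I' where I': "I' \<in> S" "\<And>i. i \<in> W \<Longrightarrow> (J + N) $ i \<le> I' $ i" "out I' = L"
      using L(2) unfolding cof_def by metis
    have "B $ i \<le> I' $ i" for i
      using I'(2)[of i] arg_cong[OF I'(3), of "\<lambda>v. v $ i"]
      by (auto simp: B_def out_def split: if_splits)
    then have "(I' - B) + B = I'" by (simp add: vec_eq_iff)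
    moreover have "J $ i \<le> (I' - B) $ i" if "i \<in> W" for i
      using I'(2)[OF that] that by (simp add: B_def)
    ultimately show "\<exists>I. (\<forall>i\<in>W. J $ i \<le> I $ i) \<and> I + B \<in> S"
      using I'(1) by metis
  qed
qed

section \<open>From solutions of the Macaulay system to roots\<close>

definition restr :: "'n set \<Rightarrow> nat ^ 'n \<Rightarrow> nat ^ 'n::finite" where
  "restr W I = (\<chi> i. if i \<in> W then I $ i else 0)"

definition poly_terms :: "'n set \<Rightarrow> 'n::finite trop_poly \<Rightarrow> 'n trop_monom set" where
  "poly_terms W p = {(c, I) | c I. p I = ereal c \<and> restr W I = I}"

definition partial_point :: "'n set \<Rightarrow> ('n \<Rightarrow> real) \<Rightarrow> ereal ^ 'n::finite" where
  "partial_point W a = (\<chi> i. if i \<in> W then ereal (a i) else \<infinity>)"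

lemma restr_eq_iff: "restr W I = I \<longleftrightarrow> (\<forall>i. i \<notin> W \<longrightarrow> I $ i = 0)"
  by (auto simp: restr_def vec_eq_iff)

lemma row_product:
  fixes p :: "'n::finite trop_poly"
  shows "(INF I. monom_mult J p I + y I) = (INF I. p I + y (I + J))"
proof (rule antisym)
  show "(INF I. monom_mult J p I + y I) \<le> (INF I. p I + y (I + J))"
  proof (rule INF_greatest)
    fix I
    have "monom_mult J p (I + J) = p I" by (simp add: monom_mult_def)
    then show "(INF I. monom_mult J p I + y I) \<le> p I + y (I + J)"
      by (intro INF_lower2[of "I + J"]) auto
  qed
  show "(INF I. p I + y (I + J)) \<le> (INF I. monom_mult J p I + y I)"
  proof (rule INF_greatest)
    fix I
    show "(INF I. p I + y (I + J)) \<le> monom_mult J p I + y I"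
    proof (cases "\<forall>i. J $ i \<le> I $ i")
      case True
      then have "I - J + J = I" by (simp add: vec_eq_iff)
      moreover have "monom_mult J p I = p (I - J)" using True by (simp add: monom_mult_def)
      ultimately show ?thesis by (intro INF_lower2[of "I - J"]) auto
    next
      case False
      then have "monom_mult J p I = \<infinity>" by (auto simp: monom_mult_def)
      then show ?thesis by simp
    qed
  qed
qed

lemma solves_macaulay_iff:
  "solves_macaulay F y \<longleftrightarrow>
    (\<forall>(f, g)\<in>set F. \<forall>J. (INF I. f I + y (I + J)) = (INF I. g I + y (I + J)))"
  by (simp add: solves_macaulay_def trop_mat_vec_def Ml_def Mr_def row_product
      all_set_conv_all_nth case_prod_unfold)

lemma trop_poly_R_infD:
  assumes "trop_poly_over R_inf p"
  shows "p I \<noteq> -\<infinity>" and "finite {I. p I \<noteq> \<infinity>}"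
proof -
  obtain S where S: "finite S" "\<And>I. I \<in> S \<Longrightarrow> p I \<in> R_inf" "\<And>I. I \<notin> S \<Longrightarrow> p I = \<infinity>"
    using assms unfolding trop_poly_over_def by blast
  show "p I \<noteq> -\<infinity>" using S(2,3)[of I] by (cases "I \<in> S") (auto simp: R_inf_def)
  show "finite {I. p I \<noteq> \<infinity>}" by (rule finite_subset[OF _ S(1)]) (use S(3) in blast)
qed

lemma finite_poly_terms:
  assumes "trop_poly_over R_inf p"
  shows "finite (poly_terms W p)"
proof (rule finite_subset)
  show "poly_terms W p \<subseteq> (\<lambda>I. (real_of_ereal (p I), I)) ` {I. p I \<noteq> \<infinity>}"
    by (force simp: poly_terms_def)
qed (use trop_poly_R_infD[OF assms] in simp)

text \<open>
  The weight \<open>z\<close> stands for the monomial values at a point whose coordinates outside \<open>W\<close> are \<open>\<infinity>\<close>, or for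
  a shifted solution of the Macaulay system.
\<close>

lemma INF_poly_terms:
  assumes p: "trop_poly_over R_inf p" and z: "\<And>I. restr W I \<noteq> I \<Longrightarrow> z I = \<infinity>"
  shows "(INF I. p I + z I) = (INF e\<in>poly_terms W p. ereal (fst e) + z (snd e))"
proof (rule antisym)
  show "(INF I. p I + z I) \<le> (INF e\<in>poly_terms W p. ereal (fst e) + z (snd e))"
  proof (rule INF_greatest)
    fix e assume "e \<in> poly_terms W p"
    then have "p (snd e) = ereal (fst e)" by (auto simp: poly_terms_def)
    then show "(INF I. p I + z I) \<le> ereal (fst e) + z (snd e)"
      by (intro INF_lower2[of "snd e"]) auto
  qed
  show "(INF e\<in>poly_terms W p. ereal (fst e) + z (snd e)) \<le> (INF I. p I + z I)"
  proof (rule INF_greatest)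
    fix I
    show "(INF e\<in>poly_terms W p. ereal (fst e) + z (snd e)) \<le> p I + z I"
    proof (cases "p I = \<infinity> \<or> restr W I \<noteq> I")
      case True
      then have "p I + z I = \<infinity>" using z trop_poly_R_infD(1)[OF p, of I] by auto
      then show ?thesis by (simp only: top_ereal_def[symmetric] top_greatest)
    next
      case False
      then obtain c where "p I = ereal c" using trop_poly_R_infD(1)[OF p, of I] by (cases "p I") auto
      then show ?thesis
        using False by (intro INF_lower2[of "(c, I)"]) (auto simp: poly_terms_def)
    qed
  qed
qed

lemma monom_value_partial_point:
  "monom_value I (partial_point W a) =
    (if restr W I = I then ereal (\<Sum>i\<in>UNIV. real (I $ i) * a i) else \<infinity>)"
proof (cases "restr W I = I")
  case True
  have "ereal (real (I $ i)) * partial_point W a $ i = ereal (real (I $ i) * a i)" for i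
    using True by (auto simp: partial_point_def restr_eq_iff)
  then show ?thesis using True by (simp add: monom_value_def)
next
  case False
  then obtain i where i: "i \<notin> W" "I $ i \<noteq> 0"
    by (auto simp: restr_eq_iff)
  have "ereal (real (I $ i)) * partial_point W a $ i = \<infinity>"
    using i by (simp add: partial_point_def)
  then have "monom_value I (partial_point W a) = \<infinity>"
    unfolding monom_value_def by (subst sum_Pinfty) auto
  then show ?thesis using False by simp
qed

lemma trop_eval_partial_point:
  assumes "trop_poly_over R_inf p"
  shows "trop_eval p (partial_point W a) = (INF e\<in>poly_terms W p. ereal (monom_at a e))"
proof -
  have "trop_eval p (partial_point W a) =
      (INF e\<in>poly_terms W p. ereal (fst e) + monom_value (snd e) (partial_point W a))"
    unfolding trop_eval_def by (rule INF_poly_terms[OF assms]) (simp add: monom_value_partial_point)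
  also have "\<dots> = (INF e\<in>poly_terms W p. ereal (monom_at a e))"
    by (intro INF_cong) (auto simp: poly_terms_def monom_value_partial_point monom_at_def)
  finally show ?thesis .
qed

text \<open>
  The hypotheses on \<open>W\<close> and \<open>B\<close> are those that a maximal direction of the support of \<open>y\<close> provides. For a
  solution with finite values they hold with all variables in \<open>W\<close> and \<open>B = 0\<close>.
\<close>

lemma root_of_macaulay_solution:
  fixes F :: "'n::finite minplus_system"
  assumes F: "minplus_system_over R_inf F" and sol: "solves_macaulay F y"
    and y: "\<And>I. y I \<noteq> -\<infinity>"
    and off: "\<And>I i. y (I + B) \<noteq> \<infinity> \<Longrightarrow> i \<notin> W \<Longrightarrow> I $ i = 0"
    and cofinal: "\<And>J. \<exists>I. (\<forall>i\<in>W. J $ i \<le> I $ i) \<and> y (I + B) \<noteq> \<infinity>"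
  shows "\<exists>a. is_root F (partial_point W a)"
proof -
  \<comment> \<open>ignoring the variables outside \<open>W\<close> makes the finite values of \<open>z\<close> cofinal in all directions\<close>
  define z where "z = (\<lambda>I. y (restr W I + B))"
  have cof: "\<exists>I. z (J + I) \<noteq> \<infinity>" for J
  proof -
    obtain I where I: "\<forall>i\<in>W. J $ i \<le> I $ i" "y (I + B) \<noteq> \<infinity>" using cofinal by blast
    have "restr W (J + (I - J)) = I"
      using I(1) off[OF I(2)] by (auto simp: restr_def vec_eq_iff)
    then show ?thesis using I(2) unfolding z_def by metis
  qed
  have row: "pairing z (poly_terms W p + {(c, J)}) = ereal c + (INF I. p I + y (I + (restr W J + B)))"
    if p: "trop_poly_over R_inf p" for p c J
  proof -
    have "(INF I. p I + y (I + (restr W J + B))) =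
        (INF e\<in>poly_terms W p. ereal (fst e) + y (snd e + (restr W J + B)))"
    proof (rule INF_poly_terms[OF p])
      fix I assume "restr W I \<noteq> I"
      then obtain i where "i \<notin> W" "I $ i \<noteq> 0"
        by (auto simp: restr_eq_iff)
      then show "y (I + (restr W J + B)) = \<infinity>"
        using off[of "I + restr W J" i] by (auto simp: add.assoc)
    qed
    also have "\<dots> = (INF e\<in>poly_terms W p. ereal (fst e) + z (snd e + J))"
    proof (intro INF_cong refl)
      fix e assume "e \<in> poly_terms W p"
      then have "\<And>i. i \<notin> W \<Longrightarrow> snd e $ i = 0" by (auto simp: poly_terms_def restr_eq_iff)
      then have "snd e + restr W J = restr W (snd e + J)"
        by (auto simp: restr_def vec_eq_iff)
      then show "ereal (fst e) + y (snd e + (restr W J + B)) = ereal (fst e) + z (snd e + J)"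
        by (simp add: z_def add.assoc[symmetric])
    qed
    finally have "ereal c + (INF I. p I + y (I + (restr W J + B))) =
      (INF e\<in>poly_terms W p. ereal c + (ereal (fst e) + z (snd e + J)))"
      by (simp add: INF_add_real)
    also have "\<dots> = pairing z (poly_terms W p + {(c, J)})"
    proof -
      have eq: "poly_terms W p + {(c, J)} = (\<lambda>e. e + (c, J)) ` poly_terms W p"
        by (auto simp: set_plus_def)
      have "ereal c + (ereal (fst e) + z (snd e + J)) = ereal (fst (e + (c, J))) + z (snd (e + (c, J)))" for e
        by (simp add: add.assoc[symmetric] add.commute[of c])
      then show ?thesis unfolding eq pairing_def image_image by (simp only:)
    qed
    finally show ?thesis by simp
  qed
  have poly: "trop_poly_over R_inf f" "trop_poly_over R_inf g" if "(f, g) \<in> set F" for f g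
    using F that by (auto simp: minplus_system_over_def)
  have eq1: "pairing z (poly_terms W f + {s}) = pairing z (poly_terms W g + {s})"
    if "(f, g) \<in> set F" for f g s
    using sol that poly[OF that] by (cases s) (auto simp: row solves_macaulay_iff)
  have eq: "pairing z (poly_terms W f + S) = pairing z (poly_terms W g + S)"
    if "(f, g) \<in> set F" for f g S
    unfolding pairing_plus[of z "poly_terms W f" S] pairing_plus[of z "poly_terms W g" S] eq1[OF that] ..
  \<comment> \<open>\<open>f\<close> and \<open>g\<close> lose all their monomials together: otherwise some row would be \<open>\<infinity>\<close> on one side only\<close>
  have emptyD: "poly_terms W g = {}"
    if "poly_terms W f = {}" and eq: "\<And>s. pairing z (poly_terms W f + {s}) = pairing z (poly_terms W g + {s})"
    for f g
  proof (rule ccontr)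
    assume "poly_terms W g \<noteq> {}"
    then obtain e where e: "e \<in> poly_terms W g" by blast
    obtain I where I: "z (snd e + I) \<noteq> \<infinity>" using cof by blast
    have "pairing z (poly_terms W g + {(0, I)}) \<le> ereal (fst (e + (0, I))) + z (snd (e + (0, I)))"
      unfolding pairing_def using e by (intro INF_lower) blast
    moreover have "pairing z (poly_terms W g + {(0, I)}) = \<infinity>"
      using eq[of "(0, I)"] that(1) by (simp add: pairing_def top_ereal_def)
    ultimately show False using I by simp
  qed
  interpret trop_preorder "\<lambda>U V. \<exists>H. finite H \<and> H \<noteq> {} \<and>
    (\<forall>S. pairing z (U + H + S) \<le> pairing z (V + H + S))"
    by (rule trop_preorder_pairing) (use y cof in \<open>auto simp: z_def\<close>)
  define \<F> where "\<F> = {(U, V) \<in> (\<lambda>(f, g). (poly_terms W f, poly_terms W g)) ` set F. U \<noteq> {} \<and> V \<noteq> {}}"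
  have "\<exists>a. \<forall>(U, V)\<in>\<F>. Min (monom_at a ` U) = Min (monom_at a ` V)"
  proof (rule common_point)
    have "\<F> \<subseteq> (\<lambda>(f, g). (poly_terms W f, poly_terms W g)) ` set F" unfolding \<F>_def by blast
    then show "finite \<F>" by (rule finite_subset) simp
  next
    fix U V assume "(U, V) \<in> \<F>"
    then obtain f g where fg: "(f, g) \<in> set F" "U = poly_terms W f" "V = poly_terms W g"
      and ne: "U \<noteq> {}" "V \<noteq> {}"
      by (auto simp: \<F>_def)
    show "finite U \<and> finite V \<and> U \<noteq> {} \<and> V \<noteq> {}"
      using ne poly[OF fg(1)] by (simp add: fg finite_poly_terms)
    have "pairing z (U + {0} + S) = pairing z (V + {0} + S)" for S
      using eq[OF fg(1), of S] by (simp add: fg)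
    then show "(\<exists>H. finite H \<and> H \<noteq> {} \<and> (\<forall>S. pairing z (U + H + S) \<le> pairing z (V + H + S))) \<and>
        (\<exists>H. finite H \<and> H \<noteq> {} \<and> (\<forall>S. pairing z (V + H + S) \<le> pairing z (U + H + S)))"
      by (intro conjI exI[of _ "{0}"]) simp_all
  qed
  then obtain a where a: "\<And>U V. (U, V) \<in> \<F> \<Longrightarrow> Min (monom_at a ` U) = Min (monom_at a ` V)"
    by blast
  have "trop_eval f (partial_point W a) = trop_eval g (partial_point W a)" if fg: "(f, g) \<in> set F" for f g
  proof (cases "poly_terms W f = {} \<or> poly_terms W g = {}")
    case True
    then have "poly_terms W f = {}" "poly_terms W g = {}"
      using emptyD[of f g] emptyD[of g f] eq1[OF fg] by auto
    then show ?thesis by (simp add: trop_eval_partial_point poly[OF fg])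
  next
    case False
    have INF_Min: "(INF e\<in>U. ereal (monom_at a e)) = ereal (Min (monom_at a ` U))"
      if "finite U" "U \<noteq> {}" for U
    proof (rule antisym)
      have "Min (monom_at a ` U) \<in> monom_at a ` U" using that by (intro Min_in) auto
      then show "(INF e\<in>U. ereal (monom_at a e)) \<le> ereal (Min (monom_at a ` U))"
        by (auto intro: INF_lower2)
      show "ereal (Min (monom_at a ` U)) \<le> (INF e\<in>U. ereal (monom_at a e))"
        using that by (intro INF_greatest) simp
    qed
    have "(poly_terms W f, poly_terms W g) \<in> \<F>"
      unfolding \<F>_def using fg False by (auto intro!: image_eqI[of _ _ "(f, g)"])
    then have "Min (monom_at a ` poly_terms W f) = Min (monom_at a ` poly_terms W g)" by (rule a)
    then show ?thesis
      using False by (simp add: trop_eval_partial_point poly[OF fg] INF_Min finite_poly_terms)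
  qed
  then show ?thesis by (auto simp: is_root_def)
qed

section \<open>From roots to solutions of the Macaulay system\<close>

lemma monom_value_0: "monom_value 0 x = 0"
  by (simp add: monom_value_def flip: zero_ereal_def)

lemma monom_value_add:
  assumes "\<And>i. x $ i \<in> R_inf"
  shows "monom_value (I + J) x = monom_value I x + monom_value J x"
proof -
  have "ereal (real ((I + J) $ i)) * x $ i =
      ereal (real (I $ i)) * x $ i + ereal (real (J $ i)) * x $ i" for i
    using ereal_left_distrib[of "ereal (real (I $ i))" "ereal (real (J $ i))" "x $ i"] by simp
  then show ?thesis by (simp add: monom_value_def sum.distrib)
qed

lemma monom_value_R_inf:
  fixes x :: "ereal ^ 'n::finite"
  assumes "\<And>i. x $ i \<in> R_inf"
  shows "monom_value I x \<in> R_inf"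
proof -
  have summand: "ereal (real (I $ i)) * x $ i \<noteq> -\<infinity>" for i
    using assms[of i] by (cases "x $ i") (auto simp: R_inf_def)
  have sum:  "sum f A \<noteq> -\<infinity>" if "\<And>i. f i \<noteq> -\<infinity>" for f :: "'n \<Rightarrow> ereal" and A
    using that by (induction A rule: infinite_finite_induct) auto
  have "monom_value I x \<noteq> -\<infinity>" unfolding monom_value_def by (rule sum[OF summand])
  then show ?thesis by (cases "monom_value I x") (auto simp: R_inf_def)
qed

lemma monom_value_R_fin:
  assumes "\<And>i. x $ i \<in> R_fin"
  shows "monom_value I x \<in> R_fin"
proof -
  have "ereal (real (I $ i)) * x $ i = ereal (real (I $ i) * real_of_ereal (x $ i))" for i
    using assms[of i] by (cases "x $ i") (auto simp: R_fin_def)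
  then show ?thesis by (simp add: monom_value_def R_fin_def)
qed

lemma macaulay_solution_of_root:
  fixes F :: "'n::finite minplus_system"
  assumes F: "minplus_system_over R_inf F" and x: "\<And>i. x $ i \<in> R_inf" and root: "is_root F x"
  shows "solves_macaulay F (\<lambda>I. monom_value I x)"
proof -
  have shift: "(INF I. p I + monom_value (I + J) x) =
      (if monom_value J x = \<infinity> then \<infinity> else monom_value J x + trop_eval p x)"
    if p: "trop_poly_over R_inf p" for p J
  proof (cases "monom_value J x = \<infinity>")
    case True
    have "p I + monom_value (I + J) x = \<infinity>" for I
      using True by (simp add: monom_value_add[OF x])
    then have "(INF I. p I + monom_value (I + J) x) = (INF I::nat^'n. \<infinity>)" by (simp only:)
    then show ?thesis using True by simp
  next
    case False
    then obtain r where r: "monom_value J x = ereal r"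
      using monom_value_R_inf[of x J, OF x] by (cases "monom_value J x") (auto simp: R_inf_def)
    have "p I + monom_value (I + J) x = ereal r + (p I + monom_value I x)" for I
      unfolding monom_value_add[OF x] r by (simp only: add_ac)
    then have "(INF I. p I + monom_value (I + J) x) = ereal r + trop_eval p x"
      unfolding trop_eval_def INF_add_real[symmetric] by (simp only:)
    then show ?thesis by (simp add: r)
  qed
  show ?thesis unfolding solves_macaulay_iff
  proof clarify
    fix f g J assume fg: "(f, g) \<in> set F"
    then have f: "trop_poly_over R_inf f" and g: "trop_poly_over R_inf g"
      using F by (auto simp: minplus_system_over_def)
    have "trop_eval f x = trop_eval g x" using root fg by (auto simp: is_root_def)
    then show "(INF I. f I + monom_value (I + J) x) = (INF I. g I + monom_value (I + J) x)"
      unfolding shift[OF f] shift[OF g] by (simp only:)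
  qed
qed

section \<open>The tropical dual Nullstellensatz\<close>

lemma R_fin_subset_R_inf: "R_fin \<subseteq> R_inf"
  by (auto simp: R_fin_def R_inf_def)

lemma minplus_system_over_mono:
  assumes "K \<subseteq> L" and "minplus_system_over K F"
  shows "minplus_system_over L F"
proof -
  have "trop_poly_over L p" if "trop_poly_over K p" for p :: "'a trop_poly"
    using that assms(1) unfolding trop_poly_over_def by blast
  then show ?thesis using assms(2) by (auto simp: minplus_system_over_def)
qed

theorem corollary7:
  fixes F :: "'n::finite minplus_system"
  shows "(minplus_system_over R_fin F \<longrightarrow>
      ((\<exists>a. (\<forall>i. a $ i \<in> R_fin) \<and> is_root F a) \<longleftrightarrow>
       (\<exists>y. (\<forall>I. y I \<in> R_fin) \<and> solves_macaulay F y)))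
    \<and> (minplus_system_over R_inf F \<longrightarrow>
      ((\<exists>a. (\<forall>i. a $ i \<in> R_inf) \<and> is_root F a) \<longleftrightarrow>
       (\<exists>y. (\<forall>I. y I \<in> R_inf) \<and> y 0 = 0 \<and> solves_macaulay F y)))"
proof (intro conjI impI iffI)
  assume F: "minplus_system_over R_fin F"
  have F': "minplus_system_over R_inf F"
    using minplus_system_over_mono[OF R_fin_subset_R_inf F] .
  {
    assume "\<exists>a. (\<forall>i. a $ i \<in> R_fin) \<and> is_root F a"
    then obtain a where a: "\<And>i. a $ i \<in> R_fin" and root: "is_root F a" by blast
    have "solves_macaulay F (\<lambda>I. monom_value I a)"
      using F' subsetD[OF R_fin_subset_R_inf a] root by (rule macaulay_solution_of_root)
    moreover have "\<forall>I. monom_value I a \<in> R_fin" using monom_value_R_fin[OF a] by blast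
    ultimately show "\<exists>y. (\<forall>I. y I \<in> R_fin) \<and> solves_macaulay F y"
      by (intro exI[of _ "\<lambda>I. monom_value I a"]) simp
  next
    assume "\<exists>y. (\<forall>I. y I \<in> R_fin) \<and> solves_macaulay F y"
    then obtain y where y: "\<And>I. y I \<in> R_fin" "solves_macaulay F y" by blast
    have fin: "y I \<noteq> \<infinity>" "y I \<noteq> -\<infinity>" for I using y(1)[of I] by (auto simp: R_fin_def)
    obtain a where "is_root F (partial_point UNIV a)"
      using root_of_macaulay_solution[OF F' y(2), of 0 UNIV] fin by auto
    then show "\<exists>a. (\<forall>i. a $ i \<in> R_fin) \<and> is_root F a"
      by (intro exI[of _ "partial_point UNIV a"]) (auto simp: partial_point_def R_fin_def)
  }
next
  assume F: "minplus_system_over R_inf F"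
  {
    assume "\<exists>a. (\<forall>i. a $ i \<in> R_inf) \<and> is_root F a"
    then obtain a where a: "\<And>i. a $ i \<in> R_inf" and root: "is_root F a" by blast
    have "solves_macaulay F (\<lambda>I. monom_value I a)"
      using F a root by (rule macaulay_solution_of_root)
    moreover have "\<forall>I. monom_value I a \<in> R_inf" using monom_value_R_inf[OF a] by blast
    ultimately show "\<exists>y. (\<forall>I. y I \<in> R_inf) \<and> y 0 = 0 \<and> solves_macaulay F y"
      by (intro exI[of _ "\<lambda>I. monom_value I a"]) (simp add: monom_value_0)
  next
    assume "\<exists>y. (\<forall>I. y I \<in> R_inf) \<and> y 0 = 0 \<and> solves_macaulay F y"
    then obtain y where y: "\<And>I. y I \<in> R_inf" "y 0 = 0" "solves_macaulay F y" by blast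
    have fin: "y I \<noteq> -\<infinity>" for I using y(1)[of I] by (auto simp: R_inf_def)
    have "0 \<in> {I. y I \<noteq> \<infinity>}" using y(2) by simp
    then have "{I. y I \<noteq> \<infinity>} \<noteq> {}" by blast
    then have "\<exists>W B. (\<forall>I i. y (I + B) \<noteq> \<infinity> \<longrightarrow> i \<notin> W \<longrightarrow> I $ i = 0) \<and>
        (\<forall>J. \<exists>I. (\<forall>i\<in>W. J $ i \<le> I $ i) \<and> y (I + B) \<noteq> \<infinity>)"
      by (rule maximal_direction_of_set[of "{I. y I \<noteq> \<infinity>}", unfolded mem_Collect_eq])
    then obtain W B where WB: "\<forall>I i. y (I + B) \<noteq> \<infinity> \<longrightarrow> i \<notin> W \<longrightarrow> I $ i = 0"
      "\<forall>J. \<exists>I. (\<forall>i\<in>W. J $ i \<le> I $ i) \<and> y (I + B) \<noteq> \<infinity>"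
      by (elim exE conjE)
    have "\<exists>a. is_root F (partial_point W a)"
      by (rule root_of_macaulay_solution[OF F y(3) fin WB(1)[rule_format] WB(2)[rule_format]])
    then obtain a where "is_root F (partial_point W a)" ..
    then show "\<exists>a. (\<forall>i. a $ i \<in> R_inf) \<and> is_root F a"
      by (intro exI[of _ "partial_point W a"]) (auto simp: partial_point_def R_inf_def)
  }
qed

end
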